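(* $\mathcal{W}_d\subsetneq\mathcal{D}_d$; that is, every point of $\mathcal{W}_d$ lies in $\mathcal{D}_d$, and there exists $\eta\in\mathcal{D}_d\setminus\mathcal{W}_d$.
   Context: $\mathbb{N}^*=\beta\mathbb{N}\setminus\mathbb{N}$ is the set of free ultrafilters on $\mathbb{N}$ with the topology inherited from the Stone–Čech compactification, and $\tau:\mathbb{N}^*\to\mathbb{N}^*$ the homeomorphism induced by $n\mapsto n+1$, i.e. $\tau\eta=\{S\subseteq\mathbb{N}:\{n:n+1\in S\}\in\eta\}$. $\mathcal{W}_d$ is the set of $\eta\in\mathbb{N}^*$ having an open neighbourhood $U$ such that the sets $\tau^nU$, $n\in\mathbb{Z}$, are pairwise disjoint. $\mathcal{D}_d$ is the set of $\eta\in\mathbb{N}^*$ having an open neighbourhood $U$ with $U\cap\{\tau^{-n}\eta:n\ge1\}=\emptyset$. *)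

theory Defs
  imports "HOL-Analysis.Analysis"
begin

text \<open>
  Ultrafilters on the natural numbers are elements of the library type \<^typ>\<open>nat filter\<close>;
  a set \<open>S\<close> belongs to the ultrafilter \<open>\<eta>\<close> iff \<open>eventually (\<lambda>n. n \<in> S) \<eta>\<close>.
\<close>

definition is_ultrafilter :: "'a filter \<Rightarrow> bool" where
  "is_ultrafilter F \<longleftrightarrow>
     F \<noteq> bot \<and> (\<forall>S. eventually (\<lambda>x. x \<in> S) F \<or> eventually (\<lambda>x. x \<notin> S) F)"

text \<open>The Stone--Cech compactification of the discrete space of natural numbers.\<close>

definition betaN :: "nat filter topology" where
  "betaN = topology_generated_by
     (range (\<lambda>S. {\<eta>. is_ultrafilter \<eta> \<and> eventually (\<lambda>n. n \<in> S) \<eta>}))"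

text \<open>A natural number \<open>n\<close> is embedded as the principal ultrafilter \<open>principal {n}\<close>.\<close>

definition Nstar :: "nat filter set" where
  "Nstar = topspace betaN - range (\<lambda>n. principal {n})"

definition Nstar_top :: "nat filter topology" where
  "Nstar_top = subtopology betaN Nstar"

definition tau :: "nat filter \<Rightarrow> nat filter" where
  "tau \<eta> = filtermap (\<lambda>n. n + 1) \<eta>"

text \<open>
  Integer iterates of \<open>tau\<close> on \<open>Nstar\<close>. The inverse has to be taken on \<open>Nstar\<close>: on all of
  \<open>betaN\<close> the map \<open>tau\<close> misses \<open>principal {0}\<close>.
\<close>

definition tau_pow :: "int \<Rightarrow> nat filter \<Rightarrow> nat filter" where
  "tau_pow k = (if 0 \<le> k then tau ^^ nat k else inv_into Nstar tau ^^ nat (- k))"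

definition W_d :: "nat filter set" where
  "W_d = {\<eta> \<in> Nstar. \<exists>U. openin Nstar_top U \<and> \<eta> \<in> U \<and>
     disjoint_family (\<lambda>n :: int. tau_pow n ` U)}"

definition D_d :: "nat filter set" where
  "D_d = {\<eta> \<in> Nstar. \<exists>U. openin Nstar_top U \<and> \<eta> \<in> U \<and>
     U \<inter> {tau_pow (- int n) \<eta> | n. n \<ge> 1} = {}}"


lemma eventually_tau:
  "eventually (\<lambda>n. n \<in> S) (tau \<eta>) \<longleftrightarrow> eventually (\<lambda>n. n \<in> {n. n + 1 \<in> S}) \<eta>"
  by (simp add: tau_def eventually_filtermap)

lemma topspace_betaN: "topspace betaN = {\<eta>. is_ultrafilter \<eta>}"
  by (auto simp: betaN_def intro!: exI[of _ UNIV])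

lemma topspace_Nstar_top: "topspace Nstar_top = Nstar"
  by (auto simp: Nstar_top_def Nstar_def)

lemma Nstar_iff: "\<eta> \<in> Nstar \<longleftrightarrow> is_ultrafilter \<eta> \<and> (\<forall>n. eventually (\<lambda>x. x \<noteq> n) \<eta>)"
proof -
  have "eventually (\<lambda>x. x \<noteq> n) \<eta>" if u: "is_ultrafilter \<eta>" and ne: "\<eta> \<noteq> principal {n}" for n
  proof (rule ccontr)
    assume "\<not> eventually (\<lambda>x. x \<noteq> n) \<eta>"
    then have "eventually (\<lambda>x. x \<in> {n}) \<eta>"
      using u unfolding is_ultrafilter_def by (metis (mono_tags, lifting) eventually_mono singleton_iff)
    then have le: "\<eta> \<le> principal {n}"
      by (simp add: le_principal)
    have "principal {n} \<le> \<eta>"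
    proof (rule filter_leI)
      fix P assume "eventually P \<eta>"
      with \<open>\<not> eventually (\<lambda>x. x \<noteq> n) \<eta>\<close> have "P n"
        by (metis (mono_tags, lifting) eventually_mono)
      then show "eventually P (principal {n})" by (simp add: eventually_principal)
    qed
    with le ne show False by (simp add: order_antisym)
  qed
  moreover have "\<eta> \<noteq> principal {n}" if "\<forall>n. eventually (\<lambda>x. x \<noteq> n) \<eta>" for n
    using that by (auto simp: eventually_principal)
  ultimately show ?thesis
    by (auto simp: Nstar_def topspace_betaN)
qed

lemma bij_betw_tau: "bij_betw tau Nstar Nstar"
proof (rule bij_betwI[where g = "filtercomap Suc"])
  have ev: "eventually P (tau \<eta>) \<longleftrightarrow> eventually (\<lambda>n. P (Suc n)) \<eta>" for P \<eta>
    by (simp add: tau_def eventually_filtermap)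
  show "tau \<in> Nstar \<rightarrow> Nstar"
  proof
    fix \<eta> assume a: "\<eta> \<in> Nstar"
    have "eventually (\<lambda>x. Suc x \<noteq> n) \<eta>" for n
      using a by (cases n) (auto simp: Nstar_iff)
    moreover have "is_ultrafilter (tau \<eta>)"
      unfolding is_ultrafilter_def
    proof
      show "tau \<eta> \<noteq> bot" using a by (simp add: Nstar_iff is_ultrafilter_def tau_def filtermap_bot_iff)
      show "\<forall>S. (\<forall>\<^sub>F x in tau \<eta>. x \<in> S) \<or> (\<forall>\<^sub>F x in tau \<eta>. x \<notin> S)"
      proof
        fix S show "(\<forall>\<^sub>F x in tau \<eta>. x \<in> S) \<or> (\<forall>\<^sub>F x in tau \<eta>. x \<notin> S)"
          using a[unfolded Nstar_iff is_ultrafilter_def, THEN conjunct1, THEN conjunct2, rule_format, of "{n. Suc n \<in> S}"]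
          by (simp add: ev)
      qed
    qed
    ultimately show "tau \<eta> \<in> Nstar" by (simp add: Nstar_iff ev)
  qed
  have evc: "eventually P (filtercomap Suc \<eta>) \<longleftrightarrow> eventually (\<lambda>n. n \<noteq> 0 \<longrightarrow> P (n - 1)) \<eta>" for P \<eta>
    unfolding eventually_filtercomap
  proof
    assume "\<exists>Q. eventually Q \<eta> \<and> (\<forall>x. Q (Suc x) \<longrightarrow> P x)"
    then show "eventually (\<lambda>n. n \<noteq> 0 \<longrightarrow> P (n - 1)) \<eta>"
      by (metis (mono_tags, lifting) eventually_mono Suc_pred' bot_nat_0.not_eq_extremum)
  qed (auto intro!: exI[of _ "\<lambda>n. n \<noteq> 0 \<longrightarrow> P (n - 1)"])
  show "filtercomap Suc \<in> Nstar \<rightarrow> Nstar"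
  proof
    fix \<eta> assume "\<eta> \<in> Nstar"
    then have u: "is_ultrafilter \<eta>" and f: "\<And>n. eventually (\<lambda>x. x \<noteq> n) \<eta>"
      by (auto simp: Nstar_iff)
    have evc': "eventually P (filtercomap Suc \<eta>) \<longleftrightarrow> eventually (\<lambda>n. P (n - 1)) \<eta>" for P
      unfolding evc using f[of 0] by (rule eventually_cong) auto
    have "is_ultrafilter (filtercomap Suc \<eta>)"
      unfolding is_ultrafilter_def
    proof
      show "filtercomap Suc \<eta> \<noteq> bot"
        using u evc'[of "\<lambda>_. False"] by (auto simp: is_ultrafilter_def eventually_False)
      show "\<forall>S. (\<forall>\<^sub>F x in filtercomap Suc \<eta>. x \<in> S) \<or> (\<forall>\<^sub>F x in filtercomap Suc \<eta>. x \<notin> S)"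
      proof
        fix S show "(\<forall>\<^sub>F x in filtercomap Suc \<eta>. x \<in> S) \<or> (\<forall>\<^sub>F x in filtercomap Suc \<eta>. x \<notin> S)"
          using u[unfolded is_ultrafilter_def, THEN conjunct2, rule_format, of "{n. n - 1 \<in> S}"]
          by (simp add: evc')
      qed
    qed
    moreover have "eventually (\<lambda>x. x - 1 \<noteq> n) \<eta>" for n
      using f[of 0] f[of "Suc n"] by eventually_elim auto
    ultimately show "filtercomap Suc \<eta> \<in> Nstar" by (simp add: Nstar_iff evc')
  qed
  fix \<eta> assume a: "\<eta> \<in> Nstar"
  show "filtercomap Suc (tau \<eta>) = \<eta>"
    by (simp add: filter_eq_iff evc ev)
  show "tau (filtercomap Suc \<eta>) = \<eta>"
  proof (rule filter_eqI)
    fix P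
    have "eventually (\<lambda>x. x \<noteq> 0) \<eta>" using a unfolding Nstar_iff by blast
    then show "eventually P (tau (filtercomap Suc \<eta>)) = eventually P \<eta>"
      unfolding ev evc by (rule eventually_cong) auto
  qed
qed

end

theory Submission
  imports Defs
begin

text \<open>
  A point \<open>\<eta>\<close> is in \<open>W_d\<close> iff it contains a set \<open>S\<close> all of whose intersections \<open>S \<inter> (S + n)\<close>,
  \<open>n \<ge> 1\<close>, are finite, and in \<open>D_d\<close> iff it contains a set \<open>S\<close> with \<open>S + n \<notin> \<eta>\<close> for all \<open>n \<ge> 1\<close>.
  The two are separated by the iterated limit \<open>\<eta> = lim b. lim a. (2 ^ a + 2 ^ b)\<close> along a free
  ultrafilter \<open>p\<close>. It contains \<open>S = {2 ^ a + 2 ^ b | b < a}\<close>, and for fixed \<open>n\<close> no point of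
  \<open>S + n\<close> has the form \<open>2 ^ a + 2 ^ b\<close> with \<open>b < a\<close> and \<open>b\<close> large. On the other hand, any set in
  \<open>\<eta>\<close> contains, for some \<open>b < c\<close> and \<open>p\<close>-many \<open>a\<close>, both \<open>2 ^ a + 2 ^ b\<close> and
  \<open>2 ^ a + 2 ^ c\<close>, whose difference does not depend on \<open>a\<close>.
\<close>

section \<open>Ultrafilters: negation, images, existence\<close>

lemma ultrafilter_not_eventually:
  assumes "is_ultrafilter F" "\<not> eventually P F"
  shows "eventually (\<lambda>x. \<not> P x) F"
  using assms(1)[unfolded is_ultrafilter_def, THEN conjunct2, rule_format, of "{x. P x}"] assms(2)
  by simp

lemma is_ultrafilterI:
  assumes "F \<noteq> bot" "\<And>P. eventually P F \<or> eventually (\<lambda>x. \<not> P x) F"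
  shows "is_ultrafilter F"
  using assms unfolding is_ultrafilter_def by blast

lemma is_ultrafilter_filtermap:
  assumes "is_ultrafilter F"
  shows "is_ultrafilter (filtermap f F)"
proof (rule is_ultrafilterI)
  show "filtermap f F \<noteq> bot"
    using assms by (simp add: is_ultrafilter_def filtermap_bot_iff)
  show "eventually P (filtermap f F) \<or> eventually (\<lambda>x. \<not> P x) (filtermap f F)" for P
    using ultrafilter_not_eventually[OF assms, of "\<lambda>x. P (f x)"] by (auto simp: eventually_filtermap)
qed

text \<open>Zorn's lemma for the reversed order: a minimal proper filter below \<open>F\<close> is
  an ultrafilter. Applied to \<open>sequentially\<close>, it supplies a free one.\<close>

lemma exists_ultrafilter_le:
  fixes F :: "'a filter"
  assumes "F \<noteq> bot"
  shows "\<exists>G\<le>F. is_ultrafilter G"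
proof -
  let ?A = "{G. G \<noteq> bot \<and> G \<le> F}"
  have "\<exists>m\<in>?A. \<forall>G\<in>?A. G \<le> m \<longrightarrow> G = m"
  proof (rule predicate_Zorn[where P = "\<lambda>G H. H \<le> G"])
    show "partial_order_on ?A (relation_of (\<lambda>G H. H \<le> G) ?A)"
      by (auto simp: partial_order_on_def preorder_on_def refl_on_def trans_def antisym_def
          relation_of_def)
  next
    fix C assume C: "C \<in> Chains (relation_of (\<lambda>G H. H \<le> G) ?A)"
    then have sub: "\<And>G. G \<in> C \<Longrightarrow> G \<noteq> bot \<and> G \<le> F"
      and lin: "\<And>G H. G \<in> C \<Longrightarrow> H \<in> C \<Longrightarrow> G \<le> H \<or> H \<le> G"
      by (auto simp: Chains_def relation_of_def)
    show "\<exists>u\<in>?A. \<forall>G\<in>C. u \<le> G"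
    proof (cases "C = {}")
      case True
      then show ?thesis using assms by auto
    next
      case False
      \<comment> \<open>As \<open>C\<close> is a chain, its infimum holds exactly the sets held by
        some member, so it stays proper.\<close>
      have "eventually P (Inf C) \<longleftrightarrow> (\<exists>G\<in>C. eventually P G)" for P
        by (rule eventually_Inf_base[OF False]) (use lin in \<open>force simp: le_inf_iff\<close>)
      then have "Inf C \<noteq> bot"
        using sub by (auto simp: trivial_limit_def)
      moreover have "Inf C \<le> F"
        using False sub by (meson Inf_lower2 ex_in_conv)
      ultimately show ?thesis by (auto intro: Inf_lower)
    qed
  qed
  then obtain m where m: "m \<noteq> bot" "m \<le> F" and min: "\<And>G. G \<noteq> bot \<Longrightarrow> G \<le> m \<Longrightarrow> G = m"
    by (auto intro: order_trans)
  have "is_ultrafilter m"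
  proof (rule is_ultrafilterI[OF m(1)])
    fix P
    show "eventually P m \<or> eventually (\<lambda>x. \<not> P x) m"
    proof (rule disjCI)
      assume "\<not> eventually (\<lambda>x. \<not> P x) m"
      \<comment> \<open>Adjoining \<open>P\<close> to \<open>m\<close> keeps it proper, so
        minimality says \<open>P\<close> was already there.\<close>
      then have "inf m (principal {x. P x}) \<noteq> bot"
        by (simp add: trivial_limit_def eventually_inf_principal)
      then have "inf m (principal {x. P x}) = m"
        by (rule min) simp
      then have "m \<le> principal {x. P x}"
        by (simp add: inf.order_iff)
      then show "eventually P m"
        by (simp add: le_principal)
    qed
  qed
  with m show ?thesis by blast
qed

lemma Nstar_iff_le_sequentially: "\<eta> \<in> Nstar \<longleftrightarrow> is_ultrafilter \<eta> \<and> \<eta> \<le> sequentially"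
proof -
  have "eventually (\<lambda>x. x \<noteq> n) \<eta>" if "\<eta> \<le> sequentially" for n
    using filter_leD[OF that eventually_gt_at_top[of n]] by (rule eventually_mono) simp
  moreover have "\<eta> \<le> sequentially" if ne: "\<forall>n. eventually (\<lambda>x. x \<noteq> n) \<eta>"
  proof (rule filter_leI)
    fix P assume "eventually P sequentially"
    then obtain N where N: "\<And>n. N \<le> n \<Longrightarrow> P n"
      by (auto simp: eventually_sequentially)
    have "eventually (\<lambda>x. \<forall>n\<in>{..<N}. x \<noteq> n) \<eta>"
      using ne by (simp add: eventually_ball_finite)
    then show "eventually P \<eta>"
      by (rule eventually_mono) (use N not_le in auto)
  qed
  ultimately have "\<eta> \<le> sequentially \<longleftrightarrow> (\<forall>n. eventually (\<lambda>x. x \<noteq> n) \<eta>)"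
    by blast
  then show ?thesis by (simp add: Nstar_iff)
qed

lemma filtermap_in_Nstar:
  assumes "p \<in> Nstar" "filterlim f sequentially sequentially"
  shows "filtermap f p \<in> Nstar"
  using assms is_ultrafilter_filtermap filtermap_mono[of p sequentially f]
  by (auto simp: Nstar_iff_le_sequentially filterlim_def)

section \<open>Integer powers of the shift\<close>

lemma tau_funpow: "(tau ^^ n) \<eta> = filtermap (\<lambda>m. m + n) \<eta>"
  by (induction n) (simp_all add: tau_def filtermap_filtermap filtermap_ident)

lemma tau_pow_nat: "tau_pow (int n) \<eta> = filtermap (\<lambda>m. m + n) \<eta>"
  by (simp add: tau_pow_def tau_funpow)

text \<open>Characterises negative powers without a formula for the inverse: surjectivity of
  \<open>tau\<close> on \<open>Nstar\<close> keeps every iterate of \<open>inv_into\<close> there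
  and lets the forward shifts cancel it.\<close>

lemma tau_pow_neg:
  assumes "\<eta> \<in> Nstar"
  shows "tau_pow (- int n) \<eta> \<in> Nstar \<and> filtermap (\<lambda>m. m + n) (tau_pow (- int n) \<eta>) = \<eta>"
proof -
  have inv: "inv_into Nstar tau \<zeta> \<in> Nstar" "tau (inv_into Nstar tau \<zeta>) = \<zeta>" if "\<zeta> \<in> Nstar" for \<zeta>
    using that bij_betw_tau by (auto simp: bij_betw_def inv_into_into f_inv_into_f)
  have "(inv_into Nstar tau ^^ n) \<eta> \<in> Nstar \<and> (tau ^^ n) ((inv_into Nstar tau ^^ n) \<eta>) = \<eta>"
  proof (induction n)
    case (Suc n)
    have "(tau ^^ Suc n) ((inv_into Nstar tau ^^ Suc n) \<eta>) =
        (tau ^^ n) (tau (inv_into Nstar tau ((inv_into Nstar tau ^^ n) \<eta>)))"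
      by (simp add: funpow_swap1)
    then show ?case using Suc inv by simp
  qed (simp add: assms)
  moreover have "tau_pow (- int n) = inv_into Nstar tau ^^ n"
    by (cases "n = 0") (simp_all add: tau_pow_def)
  ultimately show ?thesis by (simp add: tau_funpow)
qed

section \<open>Basic open sets of \<open>Nstar_top\<close>\<close>

lemma openin_Nstar_basis: "openin Nstar_top {\<xi> \<in> Nstar. eventually (\<lambda>n. n \<in> S) \<xi>}"
proof -
  let ?B = "{\<xi>. is_ultrafilter \<xi> \<and> eventually (\<lambda>n. n \<in> S) \<xi>}"
  have "openin betaN ?B"
    unfolding betaN_def by (rule topology_generated_by_Basis) blast
  moreover have "{\<xi> \<in> Nstar. eventually (\<lambda>n. n \<in> S) \<xi>} = ?B \<inter> Nstar"
    by (auto simp: Nstar_iff)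
  ultimately show ?thesis
    unfolding Nstar_top_def openin_subtopology by blast
qed

text \<open>The generating sets are a base and not just a subbase, because two of them meet in the
  one given by \<open>S \<inter> T\<close>.\<close>

lemma openin_Nstar_contains_basis:
  assumes "openin Nstar_top U" "\<eta> \<in> U"
  obtains S where "eventually (\<lambda>n. n \<in> S) \<eta>"
    "\<And>\<xi>. \<xi> \<in> Nstar \<Longrightarrow> eventually (\<lambda>n. n \<in> S) \<xi> \<Longrightarrow> \<xi> \<in> U"
proof -
  let ?\<S> = "range (\<lambda>S. {\<eta>. is_ultrafilter \<eta> \<and> eventually (\<lambda>n. n \<in> S) \<eta>})"
  obtain V where V: "generate_topology_on ?\<S> V" and U: "U = V \<inter> Nstar"
    using assms(1) unfolding Nstar_top_def openin_subtopology betaN_def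
    by (auto simp: openin_topology_generated_by_iff)
  have "\<forall>\<eta>\<in>V. \<exists>S. eventually (\<lambda>n. n \<in> S) \<eta> \<and>
      (\<forall>\<xi>\<in>Nstar. eventually (\<lambda>n. n \<in> S) \<xi> \<longrightarrow> \<xi> \<in> V)"
    using V
  proof induction
    case (Int a b)
    show ?case
    proof
      fix \<eta> assume "\<eta> \<in> a \<inter> b"
      then obtain S T where "eventually (\<lambda>n. n \<in> S) \<eta>" "eventually (\<lambda>n. n \<in> T) \<eta>"
        "\<forall>\<xi>\<in>Nstar. eventually (\<lambda>n. n \<in> S) \<xi> \<longrightarrow> \<xi> \<in> a"
        "\<forall>\<xi>\<in>Nstar. eventually (\<lambda>n. n \<in> T) \<xi> \<longrightarrow> \<xi> \<in> b"
        using Int.IH by blast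
      then show "\<exists>S. eventually (\<lambda>n. n \<in> S) \<eta> \<and>
          (\<forall>\<xi>\<in>Nstar. eventually (\<lambda>n. n \<in> S) \<xi> \<longrightarrow> \<xi> \<in> a \<inter> b)"
        by (intro exI[of _ "S \<inter> T"]) (simp add: eventually_conj_iff)
    qed
  next
    case (UN K)
    then show ?case by (meson Union_iff)
  next
    case (Basis s)
    then show ?case by (auto simp: Nstar_iff)
  qed simp
  with assms(2) U that show thesis by blast
qed

section \<open>Iterated limits (images of Fubini products of filters) and sums of two powers of
  two\<close>

definition iterated_limit :: "('a \<Rightarrow> 'b \<Rightarrow> 'c) \<Rightarrow> 'a filter \<Rightarrow> 'b filter \<Rightarrow> 'c filter" where
  "iterated_limit f F G = Abs_filter (\<lambda>P. \<forall>\<^sub>F b in G. \<forall>\<^sub>F a in F. P (f a b))"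

lemma eventually_iterated_limit:
  fixes f :: "'a \<Rightarrow> 'b \<Rightarrow> 'c"
  shows "eventually P (iterated_limit f F G) \<longleftrightarrow> (\<forall>\<^sub>F b in G. \<forall>\<^sub>F a in F. P (f a b))"
  unfolding iterated_limit_def
proof (rule eventually_Abs_filter, rule is_filter.intro)
  fix P Q :: "'c \<Rightarrow> bool"
  show "\<forall>\<^sub>F b in G. \<forall>\<^sub>F a in F. True" by simp
  show "\<forall>\<^sub>F b in G. \<forall>\<^sub>F a in F. P (f a b) \<and> Q (f a b)"
    if "\<forall>\<^sub>F b in G. \<forall>\<^sub>F a in F. P (f a b)" "\<forall>\<^sub>F b in G. \<forall>\<^sub>F a in F. Q (f a b)"
    using that by (simp add: eventually_conj_iff)
  show "\<forall>\<^sub>F b in G. \<forall>\<^sub>F a in F. Q (f a b)"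
    if "\<forall>x. P x \<longrightarrow> Q x" "\<forall>\<^sub>F b in G. \<forall>\<^sub>F a in F. P (f a b)"
    using that(2) by (elim eventually_mono) (use that(1) in blast)
qed

text \<open>Negation passes through each of the two quantifiers. The ordinary product filter of two
  free ultrafilters on the naturals is never an ultrafilter.\<close>

lemma is_ultrafilter_iterated_limit:
  assumes "is_ultrafilter F" "is_ultrafilter G"
  shows "is_ultrafilter (iterated_limit f F G)"
proof (rule is_ultrafilterI)
  show "iterated_limit f F G \<noteq> bot"
    using assms by (simp add: is_ultrafilter_def trivial_limit_def eventually_iterated_limit)
  fix P
  show "eventually P (iterated_limit f F G) \<or> eventually (\<lambda>x. \<not> P x) (iterated_limit f F G)"
  proof (rule disjCI)
    assume "\<not> eventually (\<lambda>x. \<not> P x) (iterated_limit f F G)"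
    then have "\<forall>\<^sub>F b in G. \<not> (\<forall>\<^sub>F a in F. \<not> P (f a b))"
      by (simp add: eventually_iterated_limit ultrafilter_not_eventually[OF assms(2)])
    then show "eventually P (iterated_limit f F G)"
      unfolding eventually_iterated_limit
      by (rule eventually_mono) (use ultrafilter_not_eventually[OF assms(1)] in fastforce)
  qed
qed

text \<open>From \<open>n < b\<close> follows \<open>2 * n < 2 ^ b\<close>. Compare leading
  exponents: if \<open>c < a\<close> the right side is too small, if \<open>a < c\<close> too large,
  and if \<open>c = a\<close> then \<open>n\<close> would be \<open>2 ^ b - 2 ^ d\<close>, at least
  half of \<open>2 ^ b\<close>.\<close>

lemma two_powers_shift:
  fixes a b c d n :: nat
  assumes "b < a" "d < c" "0 < n" "n < b"
  shows "2 ^ a + 2 ^ b \<noteq> 2 ^ c + 2 ^ d + (n :: nat)"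
proof
  assume eq: "2 ^ a + 2 ^ b = 2 ^ c + 2 ^ d + n"
  have dbl: "2 * 2 ^ i \<le> (2 :: nat) ^ j" if "i < j" for i j :: nat
    using power_increasing[of "Suc i" j "2 :: nat"] that by simp
  have n: "2 * n < 2 ^ b"
    using dbl[OF assms(4)] less_exp[of n] by linarith
  consider "c < a" | "c = a" | "a < c" by linarith
  then show False
  proof cases
    case 1
    then show ?thesis using dbl[of c a] dbl[of d c] assms(2) n eq by linarith
  next
    case 2
    then have bd: "2 ^ b = 2 ^ d + n" using eq by simp
    then have "(2 :: nat) ^ d < 2 ^ b" using assms(3) by linarith
    then have "d < b" by simp
    then show ?thesis using dbl[of d b] bd n by linarith
  next
    case 3
    then have "2 ^ a + 2 ^ a \<le> (2 :: nat) ^ c" "2 ^ b < (2 :: nat) ^ a"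
      using dbl[of a c] assms(1) by simp_all
    then show ?thesis using eq by linarith
  qed
qed

lemma W_d_subset_D_d: "W_d \<subseteq> D_d"
proof
  fix \<eta> assume "\<eta> \<in> W_d"
  then obtain U where \<eta>: "\<eta> \<in> Nstar" "\<eta> \<in> U" and U: "openin Nstar_top U"
    and disj: "disjoint_family (\<lambda>n :: int. tau_pow n ` U)"
    by (auto simp: W_d_def)
  have "tau_pow (- int n) \<eta> \<notin> U" if "n \<ge> 1" for n
  proof -
    \<comment> \<open>The same \<open>U\<close> serves: \<open>tau_pow (- int n) \<eta>\<close> lies
      in the image of \<open>U\<close>, and \<open>tau_pow 0\<close> is the identity.\<close>
    have "tau_pow 0 ` U \<inter> tau_pow (- int n) ` U = {}"
      using disj that by (intro disjoint_family_onD) auto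
    with \<eta>(2) show ?thesis by (auto simp: tau_pow_def)
  qed
  with \<eta> U show "\<eta> \<in> D_d" by (auto simp: D_d_def)
qed

section \<open>The separating point, for an arbitrary free ultrafilter \<open>p\<close>\<close>

context
  fixes p :: "nat filter" and \<eta> :: "nat filter"
  assumes p: "p \<in> Nstar"
  defines "\<eta> \<equiv> iterated_limit (\<lambda>a b. 2 ^ a + 2 ^ b) p p"
begin

lemma eventually_gt_Nstar: "eventually (\<lambda>a. n < a) p"
  using p eventually_gt_at_top[of n] by (auto simp: Nstar_iff_le_sequentially le_filter_def)

lemma two_powers_limit_in_Nstar: "\<eta> \<in> Nstar"
proof -
  have "is_ultrafilter \<eta>"
    unfolding \<eta>_def using p by (intro is_ultrafilter_iterated_limit) (simp_all add: Nstar_iff)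
  moreover have "eventually (\<lambda>x. x \<noteq> n) \<eta>" for n
    unfolding \<eta>_def eventually_iterated_limit
  proof (rule always_eventually, rule allI)
    fix b
    show "\<forall>\<^sub>F a in p. 2 ^ a + 2 ^ b \<noteq> n"
      using eventually_gt_Nstar[of n]
    proof eventually_elim
      case (elim a)
      then show ?case using less_exp[of a] by linarith
    qed
  qed
  ultimately show ?thesis by (simp add: Nstar_iff)
qed

lemma two_powers_limit_in_D_d: "\<eta> \<in> D_d"
proof -
  define S :: "nat set" where "S = {2 ^ a + 2 ^ b | a b. b < a}"
  let ?U = "{\<xi> \<in> Nstar. eventually (\<lambda>n. n \<in> S) \<xi>}"
  have "eventually (\<lambda>m. m \<in> S) \<eta>"
    unfolding \<eta>_def eventually_iterated_limit
    by (rule always_eventually, rule allI, rule eventually_mono[OF eventually_gt_Nstar])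
      (auto simp: S_def)
  moreover have "tau_pow (- int n) \<eta> \<notin> ?U" if n: "n \<ge> 1" for n
  proof
    assume "tau_pow (- int n) \<eta> \<in> ?U"
    then have "eventually (\<lambda>m. m \<in> S) (tau_pow (- int n) \<eta>)"
      by simp
    \<comment> \<open>Shifting forward by \<open>n\<close> removes the inverse and leaves a claim
      about \<open>\<eta>\<close> itself.\<close>
    then have "eventually (\<lambda>m. m \<in> (\<lambda>m. m + n) ` S) (filtermap (\<lambda>m. m + n) (tau_pow (- int n) \<eta>))"
      unfolding eventually_filtermap by (rule eventually_mono) blast
    then have "eventually (\<lambda>m. m \<in> (\<lambda>m. m + n) ` S) \<eta>"
      using tau_pow_neg[OF two_powers_limit_in_Nstar] by simp
    then have "\<forall>\<^sub>F b in p. \<forall>\<^sub>F a in p. 2 ^ a + 2 ^ b \<in> (\<lambda>m. m + n) ` S"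
      unfolding \<eta>_def eventually_iterated_limit .
    then have "\<forall>\<^sub>F b in p. False"
      using eventually_gt_Nstar[of n]
    proof eventually_elim
      case (elim b)
      from elim(1) eventually_gt_Nstar[of b] have "\<forall>\<^sub>F a in p. False"
      proof eventually_elim
        case (elim a)
        then show ?case using two_powers_shift[OF elim(2) _ _ \<open>n < b\<close>] n by (auto simp: S_def)
      qed
      then show ?case using p by (simp add: Nstar_iff is_ultrafilter_def)
    qed
    then show False using p by (simp add: Nstar_iff is_ultrafilter_def)
  qed
  ultimately show ?thesis
    using openin_Nstar_basis[of S] two_powers_limit_in_Nstar
    unfolding D_d_def by (intro CollectI conjI exI[of _ ?U]) auto
qed

lemma two_powers_limit_notin_W_d: "\<eta> \<notin> W_d"
proof
  assume "\<eta> \<in> W_d"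
  then obtain U where "openin Nstar_top U" "\<eta> \<in> U"
    and disj: "disjoint_family (\<lambda>n :: int. tau_pow n ` U)"
    by (auto simp: W_d_def)
  then obtain S where "eventually (\<lambda>n. n \<in> S) \<eta>"
    and SU: "\<And>\<xi>. \<xi> \<in> Nstar \<Longrightarrow> eventually (\<lambda>n. n \<in> S) \<xi> \<Longrightarrow> \<xi> \<in> U"
    using openin_Nstar_contains_basis by blast
  then have ev: "\<forall>\<^sub>F b in p. \<forall>\<^sub>F a in p. 2 ^ a + 2 ^ b \<in> S"
    by (simp add: \<eta>_def eventually_iterated_limit)
  have nontriv: "p \<noteq> bot" using p by (simp add: Nstar_iff is_ultrafilter_def)
  obtain b where b: "\<forall>\<^sub>F a in p. 2 ^ a + 2 ^ b \<in> S"
    using eventually_happens'[OF nontriv ev] by blast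
  \<comment> \<open>As \<open>p\<close> is free, the good exponents are unbounded, so a second one
    exists beyond \<open>b\<close>.\<close>
  obtain c where c: "\<forall>\<^sub>F a in p. 2 ^ a + 2 ^ c \<in> S" and "b < c"
    using eventually_happens'[OF nontriv eventually_conj[OF ev eventually_gt_Nstar[of b]]] by blast
  \<comment> \<open>The inner limit with the smaller exponent frozen at \<open>k\<close>; for
    \<open>k = b\<close> and \<open>k = c\<close> it is a free ultrafilter containing
    \<open>S\<close>.\<close>
  define \<xi> where "\<xi> k = filtermap (\<lambda>a. 2 ^ a + 2 ^ k :: nat) p" for k :: nat
  have lim: "filterlim (\<lambda>a. 2 ^ a + 2 ^ k :: nat) sequentially sequentially" for k :: nat
    by (rule filterlim_at_top_mono[OF filterlim_ident])
      (simp add: less_imp_le trans_le_add1)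
  have \<xi>_U: "\<xi> b \<in> U" "\<xi> c \<in> U"
    using b c by (auto simp: \<xi>_def eventually_filtermap intro!: SU filtermap_in_Nstar[OF p lim])
  \<comment> \<open>This shift carries \<open>\<xi> b\<close> to \<open>\<xi> c\<close>, so two
    different translates of \<open>U\<close> meet. It is nonzero and the subtraction is not
    truncated, since \<open>b < c\<close>.\<close>
  define n :: nat where "n = 2 ^ c - 2 ^ b"
  have "(2 :: nat) ^ b < 2 ^ c" using \<open>b < c\<close> by simp
  then have n: "n \<noteq> 0" "2 ^ b + n = 2 ^ c" by (simp_all add: n_def)
  have "tau_pow (int n) (\<xi> b) = \<xi> c"
    by (simp add: tau_pow_nat \<xi>_def filtermap_filtermap add.assoc n(2))
  then have "\<xi> c \<in> tau_pow (int n) ` U"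
    using \<xi>_U(1) by (metis imageI)
  moreover have "\<xi> c \<in> tau_pow 0 ` U"
    using \<xi>_U(2) by (simp add: tau_pow_def)
  moreover have "tau_pow (int n) ` U \<inter> tau_pow 0 ` U = {}"
    using disj n(1) by (intro disjoint_family_onD) auto
  ultimately show False by blast
qed

end

theorem theorem5p3:
  shows "W_d \<subset> D_d"
proof -
  obtain p :: "nat filter" where "p \<in> Nstar"
    using exists_ultrafilter_le[of sequentially] by (auto simp: Nstar_iff_le_sequentially)
  then show ?thesis
    using W_d_subset_D_d two_powers_limit_in_D_d two_powers_limit_notin_W_d by blast
qed

end
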